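(* Let $u_0,v_0\in\mathcal{H}$ and let $x:[t_0,+\infty[\to\mathcal{H}$ be the unique global solution of the system (DS) described in the context. Suppose that there exists $K>0$ such that $\frac{q(1-q)}{t^2}\le\epsilon(t)\le\frac{K}{t^q}$ for all $t$ large enough, and that $\int_{t_0}^{+\infty}t^q\epsilon(t)dt<+\infty$. Then the trajectory $x(t)$ converges weakly, as $t\to+\infty$, to an element of $\operatorname{argmin} g$.
   Context: $\mathcal{H}$ is a real Hilbert space with scalar product $\langle\cdot,\cdot\rangle$ and norm $\|\cdot\|$. The function $g:\mathcal{H}\to\mathbb{R}$ is convex and Fréchet differentiable, $\nabla g$ is Lipschitz continuous on bounded sets, and $\operatorname{argmin} g\neq\emptyset$. Parameters: $t_0>0$, $\alpha>0$, $0<q<1$, and either ($\gamma>0$ and $\beta\in\mathbb{R}$) or ($\gamma=0$ and $\beta>0$); if $\beta<0$ then also $t_0>\left|\frac{\beta}{\gamma}\right|^{1/q}$. Notation: $\beta(t)=\gamma+\frac{\beta}{t^q}$ (so $\beta(t)>0$ on $[t_0,+\infty[$). The function $\epsilon:[t_0,+\infty[\to\mathbb{R}_+$ is non-increasing, of class $C^1$, with $\lim_{t\to+\infty}\epsilon(t)=0$. The system (DS) is $$\ddot{x}(t)+\frac{\alpha}{t^q}\dot{x}(t)+\nabla g\big(x(t)+\beta(t)\dot{x}(t)\big)+\epsilon(t)x(t)=0,\qquad x(t_0)=u_0,\ \dot{x}(t_0)=v_0;$$ it has a unique global solution on $[t_0,+\infty[$ for all $u_0,v_0\in\mathcal{H}$.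 *)

theory Defs
  imports "HOL-Analysis.Analysis"
begin

(* On a complete space the gradient of a differentiable function exists at every
   point by the Riesz representation theorem, and it is unique. *)
definition gradient :: "('a::{real_inner, complete_space} \<Rightarrow> real) \<Rightarrow> 'a \<Rightarrow> 'a" where
  "gradient g x = (THE D. GDERIV g x :> D)"

definition argmin :: "('a \<Rightarrow> real) \<Rightarrow> 'a set" where
  "argmin g = {z. is_arg_min g (\<lambda>_. True) z}"

definition converges_weakly ::
  "('b \<Rightarrow> 'a::real_normed_vector) \<Rightarrow> 'a \<Rightarrow> 'b filter \<Rightarrow> bool" where
  "converges_weakly x z F \<longleftrightarrow>
     (\<forall>\<phi> :: 'a \<Rightarrow> real. bounded_linear \<phi> \<longrightarrow> ((\<lambda>t. \<phi> (x t)) \<longlongrightarrow> \<phi> z) F)"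

definition damping_coeff :: "real \<Rightarrow> real \<Rightarrow> real \<Rightarrow> real \<Rightarrow> real" where
  "damping_coeff \<gamma> \<beta> q t = \<gamma> + \<beta> / t powr q"

(* Derivatives are taken within {t0..}, hence one-sided at t0; the values of x
   before t0 are irrelevant. *)
definition DS_solution ::
  "('a::{real_inner, complete_space} \<Rightarrow> real) \<Rightarrow> (real \<Rightarrow> real) \<Rightarrow> real \<Rightarrow> real \<Rightarrow> real \<Rightarrow> real
     \<Rightarrow> real \<Rightarrow> 'a \<Rightarrow> 'a \<Rightarrow> (real \<Rightarrow> 'a) \<Rightarrow> bool" where
  "DS_solution g \<epsilon> \<alpha> q \<gamma> \<beta> t0 u0 v0 x \<longleftrightarrow>
     (\<exists>x' x''.
        (\<forall>t\<ge>t0. (x has_vector_derivative x' t) (at t within {t0..}) \<and>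
                (x' has_vector_derivative x'' t) (at t within {t0..}) \<and>
                x'' t + (\<alpha> / t powr q) *\<^sub>R x' t
                  + gradient g (x t + damping_coeff \<gamma> \<beta> q t *\<^sub>R x' t)
                  + \<epsilon> t *\<^sub>R x t = 0) \<and>
        x t0 = u0 \<and> x' t0 = v0)"

end

(*
  Put b in ]0,alpha[, z a minimiser of g, y = x + beta(t) x', and consider
    E_b = t^(2q) (g(y) - g(z)) + t^(2q) eps |x|^2 / 2 + |b (x - z) + t^q x'|^2 / 2
          + b (alpha - b - q t^(q-1)) |x - z|^2 / 2.
  Differentiating g(y) produces -beta(t) |grad g(y)|^2, which absorbs all cross terms with the
  gradient; the only other positive contribution, b q (1-q) t^(q-2) |x - z|^2 / 2, is compensated by
  the Tikhonov term exactly when eps >= q (1-q) / t^2.  Hence E_b' <= b |z|^2 t^q eps / 2 eventually,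
  so E_b converges for every b.  Comparing two values of b, the combination
    t^q <x - z, x'> + (alpha - q t^(q-1)) |x - z|^2 / 2
  converges, which is a relaxed first-order equation for |x - z|^2; so |x - z|^2 converges.
  Moreover y - x -> 0 and g(y) -> min g, so weak cluster points are minimisers and Opial's
  argument applies.
*)
theory Submission
  imports Defs "HOL-Real_Asymp.Real_Asymp"
begin

section \<open>Weak convergence in Hilbert spaces\<close>

text \<open>The representing vector is the minimiser of the quadratic functional \<open>J\<close>:
  the parallelogram identity makes a minimising sequence Cauchy, completeness supplies its limit,
  and minimality in each direction forces the first variation to vanish.\<close>

lemma riesz_representation_real:
  fixes f :: "'a::{real_inner, complete_space} \<Rightarrow> real"
  assumes f: "bounded_linear f"
  obtains p where "\<And>u. f u = inner p u"
proof -
  interpret f: bounded_linear f by fact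
  define J where "J u = (norm u)\<^sup>2 / 2 - f u" for u
  have parallelogram: "J ((1/2) *\<^sub>R (u + v)) = J u / 2 + J v / 2 - (norm (u - v))\<^sup>2 / 8" for u v
    unfolding J_def power2_norm_eq_inner
    by (simp add: f.scaleR f.add inner_add_left inner_add_right inner_diff_left inner_diff_right
        inner_commute field_simps)
  obtain C where C: "\<And>u. norm (f u) \<le> norm u * C" using f.bounded by blast
  have below: "J u \<ge> - C\<^sup>2 / 2" for u
  proof -
    have "f u \<le> norm u * C" using C[of u] by auto
    moreover have "0 \<le> (norm u - C)\<^sup>2" by simp
    ultimately show ?thesis unfolding J_def by (simp add: power2_diff)
  qed
  define m where "m = Inf (range J)"
  have bdd: "bdd_below (range J)" using below by (auto intro!: bdd_belowI)
  have m_le: "m \<le> J u" for u unfolding m_def by (rule cInf_lower[OF _ bdd]) simp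
  have "\<exists>u. J u < m + inverse (Suc n)" for n
  proof -
    have "Inf (range J) < m + inverse (Suc n)" by (simp add: m_def)
    then show ?thesis using cInf_lessD[of "range J"] by blast
  qed
  then obtain w where w: "\<And>n. J (w n) < m + inverse (Suc n)" by metis
  have dist_w: "(norm (w n - w k))\<^sup>2 \<le> 4 * (inverse (Suc n) + inverse (Suc k))" for n k
    using parallelogram[of "w n" "w k"] m_le[of "(1/2) *\<^sub>R (w n + w k)"] w[of n] w[of k] by simp
  have "Cauchy w"
  proof (rule CauchyI)
    fix e :: real assume e: "e > 0"
    \<comment> \<open>Each of the two terms in \<open>dist_w\<close> falls below e^2 / 8, and the
      factor 4 then gives exactly e^2.\<close>
    obtain N where N: "inverse (Suc N) < e\<^sup>2 / 8"
      using reals_Archimedean[of "e\<^sup>2 / 8"] e by auto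
    have "norm (w n - w k) < e" if "n \<ge> N" "k \<ge> N" for n k
    proof -
      have "inverse (real (Suc n)) \<le> inverse (Suc N)" "inverse (real (Suc k)) \<le> inverse (Suc N)"
        using that by (auto simp: field_simps)
      then have "(norm (w n - w k))\<^sup>2 < e\<^sup>2" using dist_w[of n k] N by argo
      then show ?thesis using e by (meson less_imp_le power2_less_imp_less)
    qed
    then show "\<exists>N. \<forall>n\<ge>N. \<forall>k\<ge>N. norm (w n - w k) < e" by blast
  qed
  then obtain p where p: "w \<longlonglongrightarrow> p" using Cauchy_convergent_iff convergent_def by blast
  have "(\<lambda>n. J (w n)) \<longlonglongrightarrow> J p"
    unfolding J_def by (intro tendsto_intros p f.tendsto) simp
  moreover have "(\<lambda>n. m + inverse (real (Suc n))) \<longlonglongrightarrow> m"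
    using LIMSEQ_inverse_real_of_nat_add by blast
  ultimately have "J p \<le> m" using w by (meson LIMSEQ_le less_imp_le)
  then have min: "J p \<le> J u" for u using m_le order_trans by blast
  have "f u = inner p u" for u
  proof (rule ccontr)
    define d where "d = f u - inner p u"
    assume "f u \<noteq> inner p u"
    then have d: "d \<noteq> 0" by (simp add: d_def)
    then have u: "(norm u)\<^sup>2 > 0" by (auto simp: d_def f.zero)
    \<comment> \<open>This step length minimises the quadratic s^2 |u|^2 / 2 - s d, whose minimum is
      negative when d is nonzero.\<close>
    define s where "s = d / (norm u)\<^sup>2"
    have "J (p + s *\<^sub>R u) - J p = s\<^sup>2 * (norm u)\<^sup>2 / 2 - s * d"
      unfolding J_def d_def power2_norm_eq_inner
      by (simp add: f.scaleR f.add inner_add_left inner_add_right inner_commute field_simps power2_eq_square)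
    also have "\<dots> = - (d\<^sup>2 / (2 * (norm u)\<^sup>2))"
      using u by (simp add: s_def field_simps power2_eq_square)
    also have "\<dots> < 0" using u d by simp
    finally show False using min[of "p + s *\<^sub>R u"] by simp
  qed
  then show thesis using that by blast
qed

text \<open>Riesz turns the derivative into an inner product, and uniqueness of derivatives makes
  the definite description in \<open>gradient\<close> well defined.\<close>

lemma GDERIV_gradient:
  fixes g :: "'a::{real_inner, complete_space} \<Rightarrow> real"
  assumes "g differentiable (at y)"
  shows "GDERIV g y :> gradient g y"
proof -
  obtain f where f: "(g has_derivative f) (at y)" using assms by (auto simp: differentiable_def)
  then obtain D where D: "\<And>u. f u = inner D u"
    using riesz_representation_real has_derivative_bounded_linear by metis
  have GD: "GDERIV g y :> D"
    unfolding gderiv_def using f D by (simp add: inner_commute[of _ D] flip: D)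
  show ?thesis unfolding gradient_def
  proof (rule theI[of "\<lambda>D. GDERIV g y :> D", OF GD])
    fix D' assume "GDERIV g y :> D'"
    then have "(\<lambda>h. inner h D') = (\<lambda>h. inner h D)"
      using GD unfolding gderiv_def by (rule has_derivative_unique)
    then have "inner (D' - D) (D' - D) = 0" by (metis inner_diff_right right_minus_eq)
    then show "D' = D" by simp
  qed
qed

text \<open>Restricting g to the line from y to u reduces the claim to the tangent inequality for
  convex functions of one real variable, taken between the parameters 0 and 1.\<close>

lemma convex_on_above_tangent_GDERIV:
  fixes g :: "'a::real_inner \<Rightarrow> real"
  assumes convex: "convex_on UNIV g" and D: "GDERIV g y :> D"
  shows "g u - g y \<ge> inner D (u - y)"
proof -
  let ?h = "\<lambda>s::real. g (y + s *\<^sub>R (u - y))"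
  have "convex_on UNIV ?h"
  proof (rule convex_onI)
    fix t a b :: real assume t: "0 < t" "t < 1"
    have "y + ((1 - t) *\<^sub>R a + t *\<^sub>R b) *\<^sub>R (u - y)
        = (1 - t) *\<^sub>R (y + a *\<^sub>R (u - y)) + t *\<^sub>R (y + b *\<^sub>R (u - y))"
      by (simp add: algebra_simps)
    then show "?h ((1 - t) *\<^sub>R a + t *\<^sub>R b) \<le> (1 - t) * ?h a + t * ?h b"
      using convex_onD[OF convex, of t "y + a *\<^sub>R (u - y)" "y + b *\<^sub>R (u - y)"] t by simp
  qed auto
  moreover have "(?h has_real_derivative inner D (u - y)) (at 0 within UNIV)"
  proof -
    have "(g has_derivative (\<lambda>h. inner h D)) (at (y + 0 *\<^sub>R (u - y)))"
      using D by (simp add: gderiv_def)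
    moreover have "((\<lambda>s. y + s *\<^sub>R (u - y)) has_derivative (\<lambda>s. s *\<^sub>R (u - y))) (at (0::real))"
      by (auto intro!: derivative_eq_intros)
    ultimately have "(?h has_derivative (\<lambda>s. inner (s *\<^sub>R (u - y)) D)) (at 0)"
      by (rule has_derivative_compose[rotated])
    moreover have "(\<lambda>s. inner (s *\<^sub>R (u - y)) D) = (*) (inner D (u - y))"
      by (auto simp: inner_commute)
    ultimately show ?thesis by (simp add: has_field_derivative_def)
  qed
  ultimately have "?h 1 - ?h 0 \<ge> inner D (u - y) * (1 - 0)"
    by (intro convex_on_imp_above_tangent[of UNIV]) auto
  then show ?thesis by simp
qed

section \<open>Weak compactness and Opial's lemma\<close>

text \<open>Weak compactness of balls through Tychonoff: each x t is viewed as the function u |-> <x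
  t, u>, which lies in a product of compact intervals. A cluster point of these functions is a
  bounded linear functional, hence given by a vector. Refining filters replace subsequences, since
  Tychonoff gives no sequential compactness.\<close>

lemma weak_cluster_point:
  fixes x :: "'b \<Rightarrow> 'a::{real_inner, complete_space}"
  assumes G: "G \<noteq> bot" and bounded: "eventually (\<lambda>t. norm (x t) \<le> M) G"
  obtains p H where "H \<le> G" "H \<noteq> bot" "\<And>u. ((\<lambda>t. inner (x t) u) \<longlongrightarrow> inner p u) H"
proof -
  let ?X = "\<lambda>t u. inner (x t) u"
  let ?U = "\<Pi>\<^sub>E u\<in>UNIV. cball (0::real) (M * norm u)"
  have "compactin (product_topology (\<lambda>_. euclidean) UNIV) ?U"
    by (subst compactin_PiE) simp
  then have "compact ?U"
    by (metis compactin_euclidean_iff euclidean_product_topology)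
  moreover have "eventually (\<lambda>f. f \<in> ?U) (filtermap ?X G)"
    unfolding eventually_filtermap using bounded
  proof eventually_elim
    case (elim t)
    have "\<bar>inner (x t) u\<bar> \<le> M * norm u" for u
      using Cauchy_Schwarz_ineq2[of "x t" u] mult_right_mono[OF elim norm_ge_zero[of u]] by linarith
    then show ?case by auto
  qed
  moreover have "filtermap ?X G \<noteq> bot" using G by (simp add: filtermap_bot_iff)
  ultimately obtain f where f: "f \<in> ?U" "inf (nhds f) (filtermap ?X G) \<noteq> bot"
    unfolding compact_filter by blast
  \<comment> \<open>The coarsest refinement of G along which the functionals tend to f; it is proper
    because f is a cluster point.\<close>
  define H where "H = inf G (filtercomap ?X (nhds f))"
  have H_le: "H \<le> G" by (simp add: H_def)
  have H_bot: "H \<noteq> bot"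
  proof
    assume "H = bot"
    then have "eventually (\<lambda>_. False) H" by simp
    then obtain P Q where P: "eventually P G" and Q: "eventually Q (filtercomap ?X (nhds f))"
      and PQ: "\<And>t. P t \<Longrightarrow> Q t \<Longrightarrow> False"
      unfolding H_def eventually_inf by blast
    from Q obtain R where R: "eventually R (nhds f)" "\<And>t. R (?X t) \<Longrightarrow> Q t"
      by (auto simp: eventually_filtercomap)
    have "eventually (\<lambda>k. \<not> R k) (filtermap ?X G)"
      unfolding eventually_filtermap using P by eventually_elim (use PQ R in blast)
    then have "eventually (\<lambda>_. False) (inf (nhds f) (filtermap ?X G))"
      unfolding eventually_inf using R(1) by (intro exI[of _ R] exI[of _ "\<lambda>k. \<not> R k"]) auto
    then show False using f(2) by (simp add: trivial_limit_def)
  qed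
  have "filterlim ?X (nhds f) H"
    unfolding H_def by (meson filterlim_filtercomap filterlim_mono inf_le2 order_refl)
  then have lim: "((\<lambda>t. inner (x t) u) \<longlongrightarrow> f u) H" for u
    unfolding tendsto_def[of ?X]
  proof (intro topological_tendstoI)
    fix W :: "real set" assume "open W" "f u \<in> W"
    moreover have "open ((\<lambda>k. k u) -` W :: ('a \<Rightarrow> real) set)"
      using \<open>open W\<close> continuous_on_product_coordinates by (rule open_vimage)
    ultimately show "eventually (\<lambda>t. inner (x t) u \<in> W) H"
      using \<open>filterlim ?X (nhds f) H\<close> topological_tendstoD by fastforce
  qed
  \<comment> \<open>Additivity and homogeneity pass to the limit along H; the bound comes from
    membership in the compact box \<open>?U\<close>.\<close>
  have "bounded_linear f"
  proof (rule bounded_linear_intro)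
    show "f (u + v) = f u + f v" for u v
      using tendsto_unique[OF H_bot lim[of "u + v"]] tendsto_add[OF lim[of u] lim[of v]]
      by (simp add: inner_add_right)
    show "f (r *\<^sub>R u) = r *\<^sub>R f u" for r u
      using tendsto_unique[OF H_bot lim[of "r *\<^sub>R u"]] tendsto_mult_left[OF lim[of u], of r]
      by simp
    show "norm (f u) \<le> norm u * M" for u
      using f(1) by (auto simp: PiE_iff mult.commute)
  qed
  then obtain p where "\<And>u. f u = inner p u" using riesz_representation_real by blast
  with lim have "\<And>u. ((\<lambda>t. inner (x t) u) \<longlongrightarrow> inner p u) H" by simp
  then show thesis using that H_le H_bot by blast
qed

text \<open>Two weak cluster points p and p' in S must agree: convergence of both distances makes <x
  t, p' - p> converge, so p and p' have the same inner product with p' - p. A bounded family with a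
  single weak cluster point converges weakly to it.\<close>

lemma opial:
  fixes x :: "'b \<Rightarrow> 'a::{real_inner, complete_space}"
  assumes F: "F \<noteq> bot" and S: "S \<noteq> {}"
    and norm_conv: "\<And>z. z \<in> S \<Longrightarrow> \<exists>l. ((\<lambda>t. (norm (x t - z))\<^sup>2) \<longlongrightarrow> l) F"
    and cluster: "\<And>p H. H \<le> F \<Longrightarrow> H \<noteq> bot \<Longrightarrow> (\<And>u. ((\<lambda>t. inner (x t) u) \<longlongrightarrow> inner p u) H) \<Longrightarrow> p \<in> S"
  shows "\<exists>z\<in>S. converges_weakly x z F"
proof -
  \<comment> \<open>Convergence of the distance to one point of S already bounds the trajectory
    eventually.\<close>
  obtain z0 where z0: "z0 \<in> S" using S by blast
  then obtain l where "((\<lambda>t. (norm (x t - z0))\<^sup>2) \<longlongrightarrow> l) F" using norm_conv by blast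
  then have "((\<lambda>t. sqrt ((norm (x t - z0))\<^sup>2)) \<longlongrightarrow> sqrt l) F" by (rule tendsto_real_sqrt)
  then have "eventually (\<lambda>t. norm (x t - z0) < sqrt l + 1) F"
    by (intro order_tendstoD(2)) auto
  then have bnd: "eventually (\<lambda>t. norm (x t) \<le> sqrt l + 1 + norm z0) F"
    by eventually_elim (use norm_triangle_sub in \<open>smt (verit)\<close>)
  from weak_cluster_point[OF F bnd] obtain p H
    where p: "H \<le> F" "H \<noteq> bot" "\<And>u. ((\<lambda>t. inner (x t) u) \<longlongrightarrow> inner p u) H" by metis
  have pS: "p \<in> S" using cluster p by blast
  have unique: "p' = p"
    if p': "H' \<le> F" "H' \<noteq> bot" "\<And>u. ((\<lambda>t. inner (x t) u) \<longlongrightarrow> inner p' u) H'" for p' H'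
  proof -
    have p'S: "p' \<in> S" using cluster p' by blast
    obtain l1 l2 where l: "((\<lambda>t. (norm (x t - p))\<^sup>2) \<longlongrightarrow> l1) F" "((\<lambda>t. (norm (x t - p'))\<^sup>2) \<longlongrightarrow> l2) F"
      using norm_conv pS p'S by metis
    \<comment> \<open>By polarisation, the limit of <x t, p' - p>.\<close>
    let ?m = "(l1 - l2 - (norm p)\<^sup>2 + (norm p')\<^sup>2) / 2"
    have "((\<lambda>t. ((norm (x t - p))\<^sup>2 - (norm (x t - p'))\<^sup>2 - (norm p)\<^sup>2 + (norm p')\<^sup>2) / 2) \<longlongrightarrow> ?m) F"
      by (intro tendsto_intros l) simp
    moreover have "((norm (x t - p))\<^sup>2 - (norm (x t - p'))\<^sup>2 - (norm p)\<^sup>2 + (norm p')\<^sup>2) / 2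
        = inner (x t) (p' - p)" for t
      unfolding power2_norm_eq_inner by (simp add: inner_diff_left inner_diff_right inner_commute)
    ultimately have m: "((\<lambda>t. inner (x t) (p' - p)) \<longlongrightarrow> ?m) F" by simp
    have "inner p (p' - p) = ?m"
      using tendsto_unique[OF p(2) p(3) tendsto_mono[OF p(1) m]] .
    moreover have "inner p' (p' - p) = ?m"
      using tendsto_unique[OF p'(2) p'(3) tendsto_mono[OF p'(1) m]] .
    ultimately have "inner (p' - p) (p' - p) = 0" by (simp add: inner_diff_left)
    then show "p' = p" by simp
  qed
  have weak: "((\<lambda>t. inner (x t) u) \<longlongrightarrow> inner p u) F" for u
  proof (rule ccontr)
    assume "\<not> ((\<lambda>t. inner (x t) u) \<longlongrightarrow> inner p u) F"
    then obtain W where W: "open W" "inner p u \<in> W" "\<not> eventually (\<lambda>t. inner (x t) u \<in> W) F"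
      by (auto simp: tendsto_def)
    \<comment> \<open>The part of F on which <x t, u> avoids the neighbourhood W. It is proper, so
      it has a weak cluster point of its own, which must again be p and cannot avoid W.\<close>
    define G where "G = inf F (principal {t. inner (x t) u \<notin> W})"
    have "G \<noteq> bot"
    proof
      assume "G = bot"
      then have "eventually (\<lambda>_. False) G" by simp
      then show False using W(3) by (simp add: G_def eventually_inf_principal)
    qed
    moreover have GF: "G \<le> F" by (simp add: G_def)
    ultimately obtain p' H' where p': "H' \<le> G" "H' \<noteq> bot" "\<And>u. ((\<lambda>t. inner (x t) u) \<longlongrightarrow> inner p' u) H'"
      using weak_cluster_point[of G x] bnd filter_leD by metis
    then have "p' = p" using unique GF order_trans by blast
    then have "eventually (\<lambda>t. inner (x t) u \<in> W) H'" using p'(3) W topological_tendstoD by blast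
    moreover have "eventually (\<lambda>t. inner (x t) u \<notin> W) H'"
    proof (rule filter_leD[OF p'(1)])
      show "eventually (\<lambda>t. inner (x t) u \<notin> W) G"
        by (simp add: G_def eventually_inf_principal)
    qed
    ultimately have "eventually (\<lambda>_. False) H'" by eventually_elim simp
    then show False using p'(2) by (simp add: trivial_limit_def)
  qed
  have "converges_weakly x p F"
    unfolding converges_weakly_def
  proof (intro allI impI)
    fix \<phi> :: "'a \<Rightarrow> real" assume "bounded_linear \<phi>"
    then obtain u where "\<And>v. \<phi> v = inner u v" using riesz_representation_real by blast
    then show "((\<lambda>t. \<phi> (x t)) \<longlongrightarrow> \<phi> p) F" using weak[of u] by (simp add: inner_commute)
  qed
  then show ?thesis using pS by blast
qed

section \<open>Limits of real functions\<close>

lemma nonincreasing_bounded_below_converges: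
  fixes f :: "real \<Rightarrow> real"
  assumes mono: "\<And>s t. T \<le> s \<Longrightarrow> s \<le> t \<Longrightarrow> f t \<le> f s" and below: "\<And>t. T \<le> t \<Longrightarrow> c \<le> f t"
  shows "\<exists>l. (f \<longlongrightarrow> l) at_top"
proof (intro exI decreasing_tendsto)
  have bdd: "bdd_below (f ` {T..})" using below by (auto intro!: bdd_belowI)
  show "eventually (\<lambda>t. Inf (f ` {T..}) \<le> f t) at_top"
    using eventually_ge_at_top[of T] by eventually_elim (auto intro!: cInf_lower bdd)
  fix y assume "Inf (f ` {T..}) < y"
  then obtain s where s: "s \<ge> T" "f s < y" using cInf_lessD[of "f ` {T..}"] by auto
  show "eventually (\<lambda>t. f t < y) at_top"
    using eventually_ge_at_top[of s] by eventually_elim (use mono s in fastforce)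
qed

text \<open>E - c F is nonincreasing, and bounded below since E is nonnegative and F converges;
  adding back c F gives the limit of E. With F a primitive of an integrable function, this is the
  usual Lyapunov argument.\<close>

lemma converges_if_derivative_dominated:
  fixes E F :: "real \<Rightarrow> real"
  assumes E: "eventually (\<lambda>t. 0 \<le> E t \<and> (E has_real_derivative E' t) (at t) \<and> E' t \<le> c * F' t) at_top"
    and F: "eventually (\<lambda>t. (F has_real_derivative F' t) (at t)) at_top" "(F \<longlongrightarrow> l) at_top"
  shows "\<exists>m. (E \<longlongrightarrow> m) at_top"
proof -
  have "((\<lambda>t. - c * F t) \<longlongrightarrow> - c * l) at_top" by (intro tendsto_intros F)
  then have "eventually (\<lambda>t. - c * F t > - c * l - 1) at_top" by (intro order_tendstoD(1)) auto
  then obtain T where T: "\<And>t. t \<ge> T \<Longrightarrow> 0 \<le> E t \<and> (E has_real_derivative E' t) (at t) \<and> E' t \<le> c * F' t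
      \<and> (F has_real_derivative F' t) (at t) \<and> - c * F t > - c * l - 1"
    using eventually_conj[OF E eventually_conj[OF F(1)]] unfolding eventually_at_top_linorder
    by (metis (no_types, lifting))
  have "\<exists>m. ((\<lambda>t. E t - c * F t) \<longlongrightarrow> m) at_top"
  proof (rule nonincreasing_bounded_below_converges)
    fix s t assume st: "T \<le> s" "s \<le> t"
    show "E t - c * F t \<le> E s - c * F s"
    proof (rule DERIV_nonpos_imp_nonincreasing[OF st(2)])
      fix r assume "s \<le> r" "r \<le> t"
      then have "T \<le> r" using st by simp
      from T[OF this] show "\<exists>y. ((\<lambda>t. E t - c * F t) has_real_derivative y) (at r) \<and> y \<le> 0"
        by (intro exI[of _ "E' r - c * F' r"]) (auto intro!: derivative_eq_intros)
    qed
  next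
    fix t assume "T \<le> t"
    from T[OF this] show "- c * l - 1 \<le> E t - c * F t" by auto
  qed
  then obtain m where "((\<lambda>t. E t - c * F t) \<longlongrightarrow> m) at_top" by blast
  then have "((\<lambda>t. (E t - c * F t) + c * F t) \<longlongrightarrow> m + c * l) at_top" by (intro tendsto_intros F)
  then show ?thesis by auto
qed

text \<open>Restates integrability as convergence of a primitive: the integral over
  \<open>{a..t}\<close> increases with t and is bounded by the integral over
  \<open>{a..}\<close>.\<close>

lemma improper_primitive_converges:
  fixes f :: "real \<Rightarrow> real"
  assumes cont: "continuous_on {a..} f" and nonneg: "\<And>t. t \<ge> a \<Longrightarrow> 0 \<le> f t"
    and int: "set_integrable lborel {a..} f"
  obtains F l where "\<And>t. t > a \<Longrightarrow> (F has_real_derivative f t) (at t)" "(F \<longlongrightarrow> l) at_top"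
proof -
  define F where "F t = integral {a..t} f" for t
  have int': "f integrable_on {a..}" using set_borel_integral_eq_integral(1)[OF int] .
  have int_Icc: "f integrable_on {s..t}" if "a \<le> s" for s t
    using that cont by (intro integrable_continuous_interval) (auto intro: continuous_on_subset)
  have deriv: "(F has_real_derivative f t) (at t)" if "t > a" for t
  proof -
    have "((\<lambda>u. integral {a..u} f) has_real_derivative f t) (at t within {a..t + 1})"
      using that cont by (intro integral_has_real_derivative) (auto intro: continuous_on_subset)
    then show ?thesis using that at_within_Icc_at[of a t "t + 1"] by (simp add: F_def[abs_def])
  qed
  have "\<exists>l. ((\<lambda>t. - F t) \<longlongrightarrow> l) at_top"
  proof (rule nonincreasing_bounded_below_converges)
    show "- F t \<le> - F s" if "a \<le> s" "s \<le> t" for s t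
      unfolding F_def using that nonneg by (auto intro!: integral_subset_le int_Icc)
    show "- integral {a..} f \<le> - F t" if "a \<le> t" for t
      unfolding F_def using that nonneg int' by (auto intro!: integral_subset_le int_Icc)
  qed
  then obtain l where "((\<lambda>t. - F t) \<longlongrightarrow> l) at_top" by blast
  then have "(F \<longlongrightarrow> - l) at_top" using tendsto_minus by fastforce
  with deriv show thesis by (rule that)
qed

text \<open>By the mean value theorem F t - F (t - 1) is a value s^q \<epsilon>(s) with s in ]t - 1,
  t[. Monotonicity of \<epsilon> makes it dominate t^q \<epsilon>(t) up to a constant, while
  convergence of F makes it vanish.\<close>

lemma powr_mult_antimono_tendsto_0:
  fixes \<epsilon> F :: "real \<Rightarrow> real"
  assumes q: "0 \<le> q" and a: "0 \<le> a" and nonneg: "\<And>t. t \<ge> a \<Longrightarrow> 0 \<le> \<epsilon> t" and antimono: "antimono_on {a..} \<epsilon>"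
    and F: "\<And>t. t > a \<Longrightarrow> (F has_real_derivative t powr q * \<epsilon> t) (at t)" "(F \<longlongrightarrow> l) at_top"
  shows "((\<lambda>t. t powr q * \<epsilon> t) \<longlongrightarrow> 0) at_top"
proof (rule tendsto_sandwich)
  show "eventually (\<lambda>t. 0 \<le> t powr q * \<epsilon> t) at_top"
    using eventually_ge_at_top[of a] by eventually_elim (simp add: nonneg)
  \<comment> \<open>The constant comes from t \<le> 2 s, valid for s > t - 1 and t > 2; the
    threshold a + 2 ensures this and keeps t - 1 above a.\<close>
  show "eventually (\<lambda>t. t powr q * \<epsilon> t \<le> 2 powr q * (F t - F (t - 1))) at_top"
    using eventually_gt_at_top[of "a + 2"]
  proof eventually_elim
    case (elim t)
    obtain s where s: "t - 1 < s" "s < t" "F t - F (t - 1) = (t - (t - 1)) * (s powr q * \<epsilon> s)"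
      using MVT2[of "t - 1" t F "\<lambda>s. s powr q * \<epsilon> s"] elim F(1) by force
    have "t powr q \<le> (2 * s) powr q" using s elim a q by (intro powr_mono2) auto
    also have "\<dots> = 2 powr q * s powr q" using s elim a by (simp add: powr_mult)
    finally have "t powr q * \<epsilon> t \<le> (2 powr q * s powr q) * \<epsilon> s"
      using monotone_onD[OF antimono, of s t] s elim nonneg by (intro mult_mono) auto
    then show ?case using s by (simp add: mult.assoc)
  qed
  have "((\<lambda>t. F (t - 1)) \<longlongrightarrow> l) at_top"
    by (rule filterlim_compose[OF F(2)]) real_asymp
  then have "((\<lambda>t. 2 powr q * (F t - F (t - 1))) \<longlongrightarrow> 2 powr q * (l - l)) at_top"
    by (intro tendsto_intros F)
  then show "((\<lambda>t. 2 powr q * (F t - F (t - 1))) \<longlongrightarrow> 0) at_top" by simp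
qed simp

text \<open>The integrating factor w with t^q w' = \<alpha> w tends to infinity because q < 1, and
  (h w)' / w' equals (t^q h' + \<alpha> h) / \<alpha>. L'Hospital's rule for h w / w then gives the
  limit, with no assumption on the growth of h.\<close>

lemma relaxation_ode_tendsto:
  fixes h :: "real \<Rightarrow> real"
  assumes q: "q < 1" and \<alpha>: "\<alpha> > 0"
    and h: "eventually (\<lambda>t. (h has_real_derivative h' t) (at t)) at_top"
    and lim: "((\<lambda>t. t powr q * h' t + \<alpha> * h t) \<longlongrightarrow> L) at_top"
  shows "(h \<longlongrightarrow> L / \<alpha>) at_top"
proof -
  define k where "k = \<alpha> / (1 - q)"
  define w where "w t = exp (k * t powr (1 - q))" for t
  define w' where "w' t = w t * (\<alpha> * t powr (- q))" for t
  have k: "k > 0" "k * (1 - q) = \<alpha>" using q \<alpha> by (auto simp: k_def)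
  have w: "(w has_real_derivative w' t) (at t)" if "t > 0" for t
    unfolding w_def[abs_def] w'_def k(2)[symmetric] using that
    by (auto intro!: derivative_eq_intros simp: w_def algebra_simps)
  have "filterlim (\<lambda>t. t powr (1 - q)) at_top at_top"
    using q by (intro real_powr_at_top) simp
  then have "filterlim (\<lambda>t. k * t powr (1 - q)) at_top at_top"
    using k by (intro filterlim_tendsto_pos_mult_at_top[OF tendsto_const])
  then have w_top: "filterlim w at_top at_top"
    unfolding w_def[abs_def] by (rule filterlim_compose[OF exp_at_top])
  have "((\<lambda>t. (h t * w t) / w t) \<longlongrightarrow> L / \<alpha>) at_top"
  proof (rule lhospital_at_top_at_top[OF w_top])
    show "eventually (\<lambda>t. w' t \<noteq> 0) at_top"
      using eventually_gt_at_top[of 0] by eventually_elim (use \<alpha> in \<open>auto simp: w'_def w_def\<close>)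
    show "eventually (\<lambda>t. (w has_real_derivative w' t) (at t)) at_top"
      using eventually_gt_at_top[of 0] by eventually_elim (rule w)
    show "eventually (\<lambda>t. ((\<lambda>t. h t * w t) has_real_derivative h' t * w t + h t * w' t) (at t)) at_top"
      using eventually_gt_at_top[of 0] h
      by eventually_elim (auto intro!: derivative_eq_intros w)
    have "((\<lambda>t. (t powr q * h' t + \<alpha> * h t) / \<alpha>) \<longlongrightarrow> L / \<alpha>) at_top"
      using \<alpha> by (intro tendsto_intros lim) simp
    moreover have "eventually (\<lambda>t. (t powr q * h' t + \<alpha> * h t) / \<alpha> = (h' t * w t + h t * w' t) / w' t) at_top"
      using eventually_gt_at_top[of 0]
    proof eventually_elim
      case (elim t)
      have "w t > 0" by (simp add: w_def)
      then show ?case using elim \<alpha> by (simp add: w'_def powr_minus field_simps)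
    qed
    ultimately show "((\<lambda>t. (h' t * w t + h t * w' t) / w' t) \<longlongrightarrow> L / \<alpha>) at_top"
      by (rule Lim_transform_eventually)
  qed
  moreover have "w t \<noteq> 0" for t by (simp add: w_def)
  ultimately show ?thesis by simp
qed

section \<open>Asymptotics of the damping coefficient\<close>

lemma damping_coeff_tendsto:
  assumes "0 < q"
  shows "((\<lambda>t. damping_coeff \<gamma> \<beta> q t) \<longlongrightarrow> \<gamma>) at_top"
  unfolding damping_coeff_def using assms by real_asymp

lemma damping_coeff_has_derivative:
  assumes "t > 0"
  shows "((\<lambda>t. damping_coeff \<gamma> \<beta> q t) has_real_derivative - \<beta> * q * t powr (- q - 1)) (at t)"
  unfolding damping_coeff_def using assms
  by (auto intro!: derivative_eq_intros simp: powr_diff powr_minus field_simps power2_eq_square)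

lemma eventually_damping_coeff_pos:
  assumes q: "0 < q" and \<gamma>\<beta>: "\<gamma> > 0 \<or> (\<gamma> = 0 \<and> \<beta> > 0)"
  shows "eventually (\<lambda>t. 0 < damping_coeff \<gamma> \<beta> q t) at_top"
proof (cases "\<gamma> > 0")
  case True
  then show ?thesis using order_tendstoD(1)[OF damping_coeff_tendsto[OF q]] by blast
next
  case False
  show ?thesis using eventually_gt_at_top[of 0]
    by eventually_elim (use \<gamma>\<beta> False in \<open>auto simp: damping_coeff_def\<close>)
qed

text \<open>The left side equals |\<beta>| q / t. It is beaten by a positive limit \<gamma>, or, if
  \<gamma> = 0, by \<beta> / t^q, which decays more slowly as q < 1.\<close>

lemma eventually_damping_coeff_derivative_le:
  assumes q: "0 < q" "q < 1" and \<gamma>\<beta>: "\<gamma> > 0 \<or> (\<gamma> = 0 \<and> \<beta> > 0)"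
  shows "eventually (\<lambda>t. t powr q * \<bar>- \<beta> * q * t powr (- q - 1)\<bar> \<le> damping_coeff \<gamma> \<beta> q t) at_top"
proof -
  have eq: "eventually (\<lambda>t. t powr q * \<bar>- \<beta> * q * t powr (- q - 1)\<bar> = \<bar>\<beta>\<bar> * q / t) at_top"
    using eventually_gt_at_top[of 0]
    by eventually_elim (use q in \<open>simp add: abs_mult powr_diff powr_minus field_simps\<close>)
  have "eventually (\<lambda>t. \<bar>\<beta>\<bar> * q / t \<le> damping_coeff \<gamma> \<beta> q t) at_top"
  proof (cases "\<gamma> > 0")
    case True
    have "((\<lambda>t. damping_coeff \<gamma> \<beta> q t - \<bar>\<beta>\<bar> * q / t) \<longlongrightarrow> \<gamma> - 0) at_top"
      by (intro tendsto_diff damping_coeff_tendsto q) real_asymp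
    then have "eventually (\<lambda>t. 0 < damping_coeff \<gamma> \<beta> q t - \<bar>\<beta>\<bar> * q / t) at_top"
      using True by (intro order_tendstoD(1)) auto
    then show ?thesis by eventually_elim simp
  next
    case False
    then have \<gamma>: "\<gamma> = 0" and \<beta>: "\<beta> > 0" using \<gamma>\<beta> by auto
    have "eventually (\<lambda>t. q * t powr q \<le> t) at_top" using q by real_asymp
    then show ?thesis using eventually_gt_at_top[of 0]
    proof eventually_elim
      case (elim t)
      have "\<beta> * (q * t powr q) \<le> \<beta> * t" using elim \<beta> by (intro mult_left_mono) auto
      then show ?case using elim \<gamma> \<beta> by (simp add: damping_coeff_def field_simps)
    qed
  qed
  with eq show ?thesis by eventually_elim simp
qed

section \<open>The energy of a trajectory\<close>

text \<open>The energy estimate as pure algebra at one instant: P stands for t^q, B for the damping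
  coefficient, e for \<epsilon>, w for g(y) - min g, D for the gradient at y, V and A for velocity
  and acceleration; primes mark time derivatives. The left side is the derivative of the energy.
  Gradient and velocity dissipation absorb the cross terms, convexity absorbs the growth of the
  weight P^2, and the Tikhonov term handles the rest up to |z|^2.\<close>

lemma energy_dissipation:
  fixes X V D x z A :: "'a::real_inner" and P P' P'' B B' e e' w b \<alpha> :: real
  assumes X: "X = x - z"
    and A: "A = - ((\<alpha> / P) *\<^sub>R V + D + e *\<^sub>R x)"
    and w: "0 \<le> w" "w \<le> inner D (X + B *\<^sub>R V)"
    and e: "0 \<le> e" "e' \<le> 0" and P: "0 < P" and B: "0 < B" and b: "0 < b" "b < \<alpha>"
    and P'': "- P'' \<le> P * e" and P': "0 \<le> P'" "2 * P' \<le> b" "P' + P * B * e \<le> b / 2"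
    and B': "P * \<bar>B'\<bar> \<le> B" and damping: "(\<alpha> + 1)\<^sup>2 * B / 2 \<le> (\<alpha> - b - P') * P"
  shows "2 * P * P' * w + P\<^sup>2 * inner D (V + B' *\<^sub>R V + B *\<^sub>R A)
      + (2 * P * P' * e + P\<^sup>2 * e') * inner x x / 2 + P\<^sup>2 * e * inner x V
      + inner (b *\<^sub>R X + P *\<^sub>R V) (b *\<^sub>R V + P' *\<^sub>R V + P *\<^sub>R A)
      - b * P'' * inner X X / 2 + b * (\<alpha> - b - P') * inner X V
    \<le> b * P * e * inner z z / 2" (is "?L \<le> _")
proof -
  \<comment> \<open>The <D, V> coefficient P^2 B' - \<alpha> P B is split as R - b P B, so that the
    second part completes <D, X> to the pairing in the convexity inequality.\<close>
  define R where "R = P\<^sup>2 * B' + (b - \<alpha>) * P * B"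
  \<comment> \<open>Splits the Tikhonov pairing into squares: |X|^2 will offset \<open>P''\<close>,
    |x|^2 the remaining terms in e, and |z|^2 survives in the bound.\<close>
  have Xx: "inner X x = (inner X X + inner x x - inner z z) / 2"
    by (simp add: X inner_diff_left inner_diff_right inner_commute)
  have L: "?L = 2 * P * P' * w + R * inner D V - b * P * B * inner D V - P\<^sup>2 * B * inner D D - P\<^sup>2 * B * e * inner D x
      + (2 * P * P' * e + P\<^sup>2 * e') * inner x x / 2 - P * (\<alpha> - b - P') * inner V V
      - b * P * inner D X - b * P * e * inner X x - b * P'' * inner X X / 2"
    unfolding A R_def using P
    by (simp add: inner_add_left inner_add_right inner_diff_left inner_diff_right inner_commute
        field_simps power2_eq_square)
  have convexity: "b * P * w \<le> b * P * inner D X + b * P * B * inner D V"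
    using mult_left_mono[OF w(2), of "b * P"] b P by (simp add: inner_add_right algebra_simps)
  have i_w: "2 * P * P' * w \<le> b * P * w"
    using mult_right_mono[OF mult_left_mono[OF P'(2), of P] w(1)] P by (simp add: algebra_simps)
  have i_e': "P\<^sup>2 * e' * inner x x \<le> 0"
    using e by (simp add: mult_nonneg_nonpos mult_nonpos_nonneg)
  have i_X: "- b * P'' * inner X X \<le> b * P * e * inner X X"
    using mult_right_mono[OF mult_left_mono[OF P'', of b], of "inner X X"] b by (simp add: algebra_simps)
  have i_x: "P * P' * e * inner x x + P\<^sup>2 * B * e\<^sup>2 * inner x x \<le> b * P * e * inner x x / 2"
    using mult_right_mono[OF P'(3), of "P * e * inner x x"] P e
    by (simp add: algebra_simps power2_eq_square)
  \<comment> \<open>Young's inequality spends one half of the gradient dissipation P^2 B |D|^2; the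
    velocity part is paid by friction in \<open>i_V\<close>.\<close>
  have i_DV: "R * inner D V \<le> B * (P\<^sup>2 * inner D D + (\<alpha> + 1)\<^sup>2 * inner V V) / 2"
  proof -
    have "\<bar>R\<bar> \<le> P * (P * \<bar>B'\<bar>) + (\<alpha> - b) * P * B"
      unfolding R_def using b P B
      by (intro order_trans[OF abs_triangle_ineq]) (simp add: abs_mult power2_eq_square)
    also have "\<dots> \<le> P * B + \<alpha> * P * B"
      using B' b P B by (intro add_mono mult_left_mono mult_right_mono) auto
    finally have R: "\<bar>R\<bar> \<le> (\<alpha> + 1) * (P * B)" by (simp add: algebra_simps)
    have "R * inner D V \<le> \<bar>R\<bar> * (norm D * norm V)"
      by (metis Cauchy_Schwarz_ineq2 abs_ge_self abs_ge_zero abs_mult mult_left_mono order_trans)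
    also have "\<dots> \<le> (\<alpha> + 1) * (P * B) * (norm D * norm V)"
      using R by (intro mult_right_mono) auto
    also have "\<dots> = B * ((P * norm D) * ((\<alpha> + 1) * norm V))" by simp
    also have "\<dots> \<le> B * (((P * norm D)\<^sup>2 + ((\<alpha> + 1) * norm V)\<^sup>2) / 2)"
      using B sum_squares_bound[of "P * norm D" "(\<alpha> + 1) * norm V"] by (intro mult_left_mono) auto
    finally show ?thesis by (simp add: power_mult_distrib power2_norm_eq_inner)
  qed
  \<comment> \<open>The other half of the gradient dissipation, by expanding |D + e x|^2 \<ge>
    0.\<close>
  have i_Dx: "- (P\<^sup>2 * B * e * inner D x) \<le> P\<^sup>2 * B * (inner D D + e\<^sup>2 * inner x x) / 2"
  proof -
    have "0 \<le> P\<^sup>2 * B * inner (D + e *\<^sub>R x) (D + e *\<^sub>R x)" using B by simp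
    then show ?thesis
      by (simp add: inner_add_left inner_add_right inner_commute algebra_simps power2_eq_square)
  qed
  have i_V: "(\<alpha> + 1)\<^sup>2 * B / 2 * inner V V \<le> (\<alpha> - b - P') * P * inner V V"
    using damping by (rule mult_right_mono) simp
  have nonneg: "0 \<le> P\<^sup>2 * B * e\<^sup>2 * inner x x" using B by simp
  show ?thesis unfolding L Xx
    using convexity i_w i_e' i_X i_x i_DV i_Dx i_V nonneg by (simp add: field_simps)
qed

lemma inner_has_real_derivative:
  fixes u v :: "real \<Rightarrow> 'a::real_inner"
  assumes "(u has_vector_derivative u') (at t)" "(v has_vector_derivative v') (at t)"
  shows "((\<lambda>t. inner (u t) (v t :: 'a)) has_real_derivative inner (u t) v' + inner u' (v t)) (at t)"
proof (rule has_derivative_imp_has_field_derivative)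
  show "((\<lambda>t. inner (u t) (v t)) has_derivative (\<lambda>h. inner (u t) (h *\<^sub>R v') + inner (h *\<^sub>R u') (v t))) (at t)"
    using has_derivative_inner[OF assms[unfolded has_vector_derivative_def]] .
qed (simp add: algebra_simps)

section \<open>The energy along a trajectory\<close>

locale tikhonov_trajectory =
  fixes g :: "'a::{real_inner, complete_space} \<Rightarrow> real"
    and \<alpha> q \<gamma> \<beta> t0 :: real and \<epsilon> \<epsilon>' :: "real \<Rightarrow> real" and x x' x'' :: "real \<Rightarrow> 'a"
  assumes g_convex: "convex_on UNIV g"
    and g_diff: "\<And>y. g differentiable (at y)"
    and t0_pos: "0 < t0" and alpha_pos: "0 < \<alpha>" and q_bounds: "0 < q" "q < 1"
    and gamma_beta: "\<gamma> > 0 \<or> (\<gamma> = 0 \<and> \<beta> > 0)"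
    and eps_nonneg: "\<And>t. t \<ge> t0 \<Longrightarrow> 0 \<le> \<epsilon> t"
    and eps_antimono: "antimono_on {t0..} \<epsilon>"
    and eps_deriv: "\<And>t. t \<ge> t0 \<Longrightarrow> (\<epsilon> has_real_derivative \<epsilon>' t) (at t within {t0..})"
    and eps_lower: "eventually (\<lambda>t. q * (1 - q) / t\<^sup>2 \<le> \<epsilon> t) at_top"
    and eps_integrable: "set_integrable lborel {t0..} (\<lambda>t. t powr q * \<epsilon> t)"
    and x_deriv: "\<And>t. t > t0 \<Longrightarrow> (x has_vector_derivative x' t) (at t)"
    and x'_deriv: "\<And>t. t > t0 \<Longrightarrow> (x' has_vector_derivative x'' t) (at t)"
    and ode: "\<And>t. t > t0 \<Longrightarrow> x'' t = - ((\<alpha> / t powr q) *\<^sub>R x' t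
        + gradient g (x t + damping_coeff \<gamma> \<beta> q t *\<^sub>R x' t) + \<epsilon> t *\<^sub>R x t)"
begin

definition y :: "real \<Rightarrow> 'a" where
  "y t = x t + damping_coeff \<gamma> \<beta> q t *\<^sub>R x' t"

text \<open>The weight of the last term is chosen so that all <x - z, x'> terms cancel in the
  derivative; it also makes the energy affine in b.\<close>

definition energy :: "real \<Rightarrow> 'a \<Rightarrow> real \<Rightarrow> real" where
  "energy b z t = (t powr q)\<^sup>2 * (g (y t) - g z) + (t powr q)\<^sup>2 * \<epsilon> t * inner (x t) (x t) / 2
     + inner (b *\<^sub>R (x t - z) + t powr q *\<^sub>R x' t) (b *\<^sub>R (x t - z) + t powr q *\<^sub>R x' t) / 2
     + b * (\<alpha> - b - q * t powr (q - 1)) * inner (x t - z) (x t - z) / 2"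

lemma eps_deriv_at: "t > t0 \<Longrightarrow> (\<epsilon> has_real_derivative \<epsilon>' t) (at t)"
  using eps_deriv[of t] at_within_interior[of t "{t0..}"] by simp

lemma eps_deriv_nonpos:
  assumes "t > t0"
  shows "\<epsilon>' t \<le> 0"
proof (rule ccontr)
  assume "\<not> \<epsilon>' t \<le> 0"
  then obtain d where d: "d > 0" "\<And>h. 0 < h \<Longrightarrow> h < d \<Longrightarrow> \<epsilon> t < \<epsilon> (t + h)"
    using DERIV_pos_inc_right[OF eps_deriv_at[OF assms]] by auto
  have "\<epsilon> (t + d / 2) \<le> \<epsilon> t" using monotone_onD[OF eps_antimono, of t "t + d / 2"] assms d(1) by simp
  then show False using d(2)[of "d / 2"] d(1) by simp
qed

definition y' :: "real \<Rightarrow> 'a" where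
  "y' t = x' t + (- \<beta> * q * t powr (- q - 1)) *\<^sub>R x' t + damping_coeff \<gamma> \<beta> q t *\<^sub>R x'' t"

lemma g_y_has_derivative:
  assumes t: "t > t0"
  shows "((\<lambda>t. g (y t)) has_real_derivative inner (gradient g (y t)) (y' t)) (at t)"
proof -
  have "((\<lambda>t. damping_coeff \<gamma> \<beta> q t *\<^sub>R x' t) has_vector_derivative
      damping_coeff \<gamma> \<beta> q t *\<^sub>R x'' t + (- \<beta> * q * t powr (- q - 1)) *\<^sub>R x' t) (at t)"
    by (rule has_vector_derivative_scaleR[OF damping_coeff_has_derivative x'_deriv]) (use t t0_pos in simp_all)
  from has_vector_derivative_add[OF x_deriv[OF t] this]
  have "(y has_vector_derivative y' t) (at t)"
    by (simp add: y_def[abs_def] y'_def algebra_simps)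
  then have "(y has_derivative (\<lambda>h. h *\<^sub>R y' t)) (at t)" by (simp add: has_vector_derivative_def)
  moreover have "(g has_derivative (\<lambda>h. inner h (gradient g (y t)))) (at (y t))"
    using GDERIV_gradient[OF g_diff] by (simp add: gderiv_def)
  ultimately have "((\<lambda>t. g (y t)) has_derivative (\<lambda>h. inner (h *\<^sub>R y' t) (gradient g (y t)))) (at t)"
    by (rule has_derivative_compose)
  moreover have "(\<lambda>h. inner (h *\<^sub>R y' t) (gradient g (y t))) = (*) (inner (gradient g (y t)) (y' t))"
    by (auto simp: inner_commute)
  ultimately show ?thesis by (simp add: has_field_derivative_def)
qed

lemma energy_has_derivative:
  assumes t: "t > t0"
  defines "P \<equiv> t powr q" and "P' \<equiv> q * t powr (q - 1)" and "P'' \<equiv> q * (q - 1) * t powr (q - 2)"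
  shows "(energy b z has_real_derivative
      2 * P * P' * (g (y t) - g z) + P\<^sup>2 * inner (gradient g (y t)) (y' t)
      + (2 * P * P' * \<epsilon> t + P\<^sup>2 * \<epsilon>' t) * inner (x t) (x t) / 2 + P\<^sup>2 * \<epsilon> t * inner (x t) (x' t)
      + inner (b *\<^sub>R (x t - z) + P *\<^sub>R x' t) (b *\<^sub>R x' t + P' *\<^sub>R x' t + P *\<^sub>R x'' t)
      - b * P'' * inner (x t - z) (x t - z) / 2 + b * (\<alpha> - b - P') * inner (x t - z) (x' t)) (at t)"
proof -
  have tpos: "t > 0" using t t0_pos by simp
  have dP: "((\<lambda>t. t powr q) has_real_derivative P') (at t)"
    using tpos by (auto intro!: derivative_eq_intros simp: P'_def)
  have dP': "((\<lambda>t. q * t powr (q - 1)) has_real_derivative P'') (at t)"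
    using tpos by (auto intro!: derivative_eq_intros simp: P''_def)
  have dX: "((\<lambda>t. x t - z) has_vector_derivative x' t) (at t)"
    using x_deriv[OF t] by (auto intro!: derivative_eq_intros)
  have dPV: "((\<lambda>t. t powr q *\<^sub>R x' t) has_vector_derivative P *\<^sub>R x'' t + P' *\<^sub>R x' t) (at t)"
    unfolding P_def by (rule has_vector_derivative_scaleR[OF dP x'_deriv[OF t]])
  have dv: "((\<lambda>t. b *\<^sub>R (x t - z) + t powr q *\<^sub>R x' t) has_vector_derivative
      b *\<^sub>R x' t + (P *\<^sub>R x'' t + P' *\<^sub>R x' t)) (at t)"
    by (intro has_vector_derivative_add dPV)
       (use has_vector_derivative_scaleR[OF DERIV_const dX, of b] in simp)
  show ?thesis
    unfolding energy_def[abs_def]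
    by (rule DERIV_cong,
        (rule g_y_has_derivative[OF t] dP dP' eps_deriv_at[OF t]
          inner_has_real_derivative[OF x_deriv[OF t] x_deriv[OF t]] inner_has_real_derivative[OF dX dX]
          inner_has_real_derivative[OF dv dv] DERIV_const DERIV_add DERIV_diff DERIV_cdivide DERIV_mult DERIV_power)+)
       (simp add: P_def[symmetric] P'_def[symmetric] inner_commute field_simps power2_eq_square)
qed

lemma weighted_eps_primitive:
  obtains F l where "\<And>t. t > t0 \<Longrightarrow> (F has_real_derivative t powr q * \<epsilon> t) (at t)" "(F \<longlongrightarrow> l) at_top"
proof -
  have "continuous_on {t0..} \<epsilon>"
    using eps_deriv DERIV_continuous_on by (metis atLeast_iff)
  then have "continuous_on {t0..} (\<lambda>t. t powr q * \<epsilon> t)"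
    using t0_pos by (intro continuous_intros) auto
  then show thesis
    using eps_nonneg by (intro improper_primitive_converges[OF _ _ eps_integrable that]) auto
qed

lemma weighted_eps_tendsto_0: "((\<lambda>t. t powr q * \<epsilon> t) \<longlongrightarrow> 0) at_top"
proof -
  obtain F l where "\<And>t. t > t0 \<Longrightarrow> (F has_real_derivative t powr q * \<epsilon> t) (at t)" "(F \<longlongrightarrow> l) at_top"
    using weighted_eps_primitive by blast
  then show ?thesis
    using q_bounds t0_pos eps_nonneg eps_antimono
    by (intro powr_mult_antimono_tendsto_0[where a = t0 and F = F and l = l]) auto
qed

text \<open>For large t every summand of the energy is nonnegative, so each is bounded by the whole.
  The hypotheses of \<open>energy_dissipation\<close> hold eventually because t^q tends to infinity
  while q t^(q-1) and t^q \<epsilon>(t) vanish.\<close>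

lemma eventually_energy_bounds:
  assumes z: "z \<in> argmin g" and b: "0 < b" "b < \<alpha>"
  shows "eventually (\<lambda>t. 0 \<le> energy b z t
      \<and> (t powr q)\<^sup>2 * (g (y t) - g z) \<le> energy b z t
      \<and> inner (b *\<^sub>R (x t - z) + t powr q *\<^sub>R x' t) (b *\<^sub>R (x t - z) + t powr q *\<^sub>R x' t) / 2 \<le> energy b z t
      \<and> b * (\<alpha> - b) * inner (x t - z) (x t - z) / 4 \<le> energy b z t
      \<and> (\<exists>E'. (energy b z has_real_derivative E') (at t) \<and> E' \<le> (b * inner z z / 2) * (t powr q * \<epsilon> t))) at_top"
proof -
  let ?B = "damping_coeff \<gamma> \<beta> q"
  have P'_lim: "((\<lambda>t. q * t powr (q - 1)) \<longlongrightarrow> 0) at_top" using q_bounds by real_asymp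
  have B_lim: "(?B \<longlongrightarrow> \<gamma>) at_top" by (rule damping_coeff_tendsto[OF q_bounds(1)])
  have "((\<lambda>t. q * t powr (q - 1) + ?B t * (t powr q * \<epsilon> t)) \<longlongrightarrow> 0 + \<gamma> * 0) at_top"
    by (intro tendsto_intros P'_lim B_lim weighted_eps_tendsto_0)
  then have ev1: "eventually (\<lambda>t. q * t powr (q - 1) + ?B t * (t powr q * \<epsilon> t) < b / 2) at_top"
    using b by (intro order_tendstoD(2)) auto
  \<comment> \<open>The bound b / 2 gives 2 P' \<le> b; the bound (\<alpha> - b) / 2 preserves half
    of the friction \<alpha> - b, whence the factor 1/4 in the bound on |x - z|^2.\<close>
  have ev2: "eventually (\<lambda>t. q * t powr (q - 1) < min (b / 2) ((\<alpha> - b) / 2)) at_top"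
    using b by (intro order_tendstoD(2)[OF P'_lim]) auto
  have "filterlim (\<lambda>t. t powr q * (\<alpha> - b)/2) at_top at_top" using q_bounds b by real_asymp
  \<comment> \<open>Here \<gamma> + 1 eventually bounds the damping coefficient, so growing t^q
    times the friction dominates the Young remainder.\<close>
  then have ev3: "eventually (\<lambda>t. (\<alpha> + 1)\<^sup>2 * (\<gamma> + 1) / 2 < t powr q * (\<alpha> - b) / 2) at_top"
    unfolding filterlim_at_top_dense by blast
  have ev4: "eventually (\<lambda>t. ?B t < \<gamma> + 1) at_top" by (rule order_tendstoD(2)[OF B_lim]) simp
  show ?thesis
    using ev1 ev2 ev3 ev4 eventually_gt_at_top[of t0] eps_lower
      eventually_damping_coeff_pos[OF q_bounds(1) gamma_beta]
      eventually_damping_coeff_derivative_le[OF q_bounds gamma_beta]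
  proof eventually_elim
    case (elim t)
    define P where "P = t powr q"
    define P' where "P' = q * t powr (q - 1)"
    define P'' where "P'' = q * (q - 1) * t powr (q - 2)"
    define X where "X = x t - z"
    define D where "D = gradient g (y t)"
    have t: "t > 0" "t > t0" using elim t0_pos by auto
    have P: "P > 0" "P' \<ge> 0" using t q_bounds by (auto simp: P_def P'_def)
    have e: "0 \<le> \<epsilon> t" "\<epsilon>' t \<le> 0" using eps_nonneg eps_deriv_nonpos t by auto
    have w: "0 \<le> g (y t) - g z"
      using z by (auto simp: argmin_def is_arg_min_linorder)
    have yX: "y t - z = X + ?B t *\<^sub>R x' t" by (simp add: y_def X_def)
    have "g z - g (y t) \<ge> inner D (z - y t)"
      unfolding D_def by (rule convex_on_above_tangent_GDERIV[OF g_convex GDERIV_gradient[OF g_diff]])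
    then have w2: "g (y t) - g z \<le> inner D (X + ?B t *\<^sub>R x' t)"
      unfolding yX[symmetric] by (simp add: inner_diff_right)
    \<comment> \<open>The lower bound q (1 - q) / t^2 on \<epsilon> enters exactly here, since -
      \<open>P''\<close> is that bound times t^q.\<close>
    have P'': "- P'' \<le> P * \<epsilon> t"
    proof -
      have "- P'' = P * (q * (1 - q) / t\<^sup>2)"
        using t by (simp add: P''_def P_def powr_diff field_simps)
      also have "\<dots> \<le> P * \<epsilon> t" using P elim by (intro mult_left_mono) auto
      finally show ?thesis .
    qed
    have damping: "(\<alpha> + 1)\<^sup>2 * ?B t / 2 \<le> (\<alpha> - b - P') * P"
    proof -
      have "(\<alpha> + 1)\<^sup>2 * ?B t / 2 \<le> (\<alpha> + 1)\<^sup>2 * (\<gamma> + 1) / 2"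
        using elim by (intro divide_right_mono mult_left_mono) auto
      also have "\<dots> \<le> (\<alpha> - b) / 2 * P" using elim by (simp add: P_def mult.commute)
      also have "\<dots> \<le> (\<alpha> - b - P') * P" using elim P by (intro mult_right_mono) (auto simp: P'_def)
      finally show ?thesis .
    qed
    have A: "x'' t = - ((\<alpha> / P) *\<^sub>R x' t + D + \<epsilon> t *\<^sub>R x t)"
      using ode[OF t(2)] by (simp add: P_def D_def y_def)
    note energy_dissipation[OF X_def A w w2 e P(1) _ b P'' P(2) _ _ _ damping,
        of "- \<beta> * q * t powr (- q - 1)"]
    moreover have "P * \<bar>- \<beta> * q * t powr (- q - 1)\<bar> \<le> ?B t" "P' + P * ?B t * \<epsilon> t \<le> b / 2" "2 * P' \<le> b" "0 < ?B t"
      using elim by (auto simp: P_def P'_def mult.assoc mult.left_commute)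
    ultimately have "\<exists>E'. (energy b z has_real_derivative E') (at t) \<and> E' \<le> (b * inner z z / 2) * (P * \<epsilon> t)"
      using energy_has_derivative[OF t(2), of b z]
      unfolding P_def[symmetric] P'_def[symmetric] P''_def[symmetric] X_def[symmetric] y'_def D_def
      by (intro exI conjI) (assumption, simp add: mult_ac)
    moreover have terms: "0 \<le> P\<^sup>2 * (g (y t) - g z)" "0 \<le> P\<^sup>2 * \<epsilon> t * inner (x t) (x t) / 2"
      "0 \<le> inner (b *\<^sub>R X + P *\<^sub>R x' t) (b *\<^sub>R X + P *\<^sub>R x' t) / 2"
      using w e P by auto
    moreover have "b * (\<alpha> - b) * inner X X / 4 \<le> b * (\<alpha> - b - P') * inner X X / 2"
    proof -
      have "b * ((\<alpha> - b) / 2) * inner X X \<le> b * (\<alpha> - b - P') * inner X X"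
        using elim b by (intro mult_right_mono mult_left_mono) (auto simp: P'_def)
      then show ?thesis by (simp add: field_simps)
    qed
    moreover have "0 \<le> b * (\<alpha> - b) * inner X X / 4" using b by simp
    moreover have "energy b z t = P\<^sup>2 * (g (y t) - g z) + P\<^sup>2 * \<epsilon> t * inner (x t) (x t) / 2
        + inner (b *\<^sub>R X + P *\<^sub>R x' t) (b *\<^sub>R X + P *\<^sub>R x' t) / 2
        + b * (\<alpha> - b - P') * inner X X / 2"
      by (simp add: energy_def P_def P'_def X_def)
    ultimately show ?case
      unfolding P_def[symmetric] X_def[symmetric] by - (intro conjI; (assumption | linarith))
  qed
qed

text \<open>The energy is eventually nonnegative with derivative at most a multiple of the
  integrable t^q \<epsilon>(t). Having this for every b in ]0, \<alpha>[ allows two energies to be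
  compared later.\<close>

lemma energy_converges:
  assumes z: "z \<in> argmin g" and b: "0 < b" "b < \<alpha>"
  shows "\<exists>m. (energy b z \<longlongrightarrow> m) at_top"
proof -
  obtain F l where F: "\<And>t. t > t0 \<Longrightarrow> (F has_real_derivative t powr q * \<epsilon> t) (at t)" "(F \<longlongrightarrow> l) at_top"
    using weighted_eps_primitive by blast
  have ev: "eventually (\<lambda>t. (F has_real_derivative t powr q * \<epsilon> t) (at t)) at_top"
    using eventually_gt_at_top[of t0] by eventually_elim (rule F)
  show ?thesis
  proof (rule converges_if_derivative_dominated[OF _ ev F(2), where c = "b * inner z z / 2" and E' = "deriv (energy b z)"])
    show "eventually (\<lambda>t. 0 \<le> energy b z t \<and> (energy b z has_real_derivative deriv (energy b z) t) (at t)
        \<and> deriv (energy b z) t \<le> b * inner z z / 2 * (t powr q * \<epsilon> t)) at_top"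
      using eventually_energy_bounds[OF assms]
      by eventually_elim (auto simp: DERIV_imp_deriv)
  qed
qed

section \<open>Consequences of energy convergence\<close>

text \<open>A bounded energy bounds x - z and b (x - z) + t^q x', hence t^q x', so y - x vanishes at
  rate \<beta>(t) / t^q; it also forces g(y) - g(z) = O(t^(-2q)).\<close>

lemma asymptotics:
  assumes z: "z \<in> argmin g"
  obtains C where "eventually (\<lambda>t. inner (x t - z) (x t - z) \<le> C) at_top"
    "((\<lambda>t. y t - x t) \<longlongrightarrow> 0) at_top" "((\<lambda>t. g (y t)) \<longlongrightarrow> g z) at_top"
proof -
  define b where "b = \<alpha> / 2"
  have b: "0 < b" "b < \<alpha>" "\<alpha> - b = b" using alpha_pos by (auto simp: b_def)
  obtain m where "(energy b z \<longlongrightarrow> m) at_top" using energy_converges[OF z b(1,2)] by blast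
  then have "eventually (\<lambda>t. energy b z t < m + 1) at_top" by (rule order_tendstoD(2)) simp
  then have "eventually (\<lambda>t. (t powr q)\<^sup>2 * (g (y t) - g z) \<le> m + 1
      \<and> inner (b *\<^sub>R (x t - z) + t powr q *\<^sub>R x' t) (b *\<^sub>R (x t - z) + t powr q *\<^sub>R x' t) \<le> 2 * (m + 1)
      \<and> inner (x t - z) (x t - z) \<le> 4 * (m + 1) / b\<^sup>2) at_top"
    using eventually_energy_bounds[OF z b(1,2)]
  proof eventually_elim
    case (elim t)
    then have "b * b * inner (x t - z) (x t - z) / 4 \<le> m + 1" using b(3) by simp
    then have "inner (x t - z) (x t - z) \<le> 4 * (m + 1) / b\<^sup>2"
      using b by (simp add: field_simps power2_eq_square)
    moreover have "(t powr q)\<^sup>2 * (g (y t) - g z) \<le> m + 1" using elim by linarith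
    moreover have "inner (b *\<^sub>R (x t - z) + t powr q *\<^sub>R x' t) (b *\<^sub>R (x t - z) + t powr q *\<^sub>R x' t) \<le> 2 * (m + 1)"
      by (rule order_trans[OF _ less_imp_le[OF mult_strict_left_mono[OF elim(1)]]]) (use elim in auto)
    ultimately show ?case by blast
  qed
  then have ev: "eventually (\<lambda>t. (t powr q)\<^sup>2 * (g (y t) - g z) \<le> m + 1) at_top"
    "eventually (\<lambda>t. norm (b *\<^sub>R (x t - z) + t powr q *\<^sub>R x' t) \<le> sqrt (2 * (m + 1))) at_top"
    "eventually (\<lambda>t. norm (x t - z) \<le> sqrt (4 * (m + 1) / b\<^sup>2)) at_top"
    "eventually (\<lambda>t. inner (x t - z) (x t - z) \<le> 4 * (m + 1) / b\<^sup>2) at_top"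
    by (auto simp: eventually_conj_iff norm_eq_sqrt_inner)
  \<comment> \<open>The triangle inequality makes this a bound for t^q |x'|.\<close>
  define M where "M = sqrt (2 * (m + 1)) + b * sqrt (4 * (m + 1) / b\<^sup>2)"
  have "((\<lambda>t. y t - x t) \<longlongrightarrow> 0) at_top"
  proof (rule Lim_null_comparison)
    show "eventually (\<lambda>t. norm (y t - x t) \<le> damping_coeff \<gamma> \<beta> q t * (M / t powr q)) at_top"
      using ev(2,3) eventually_gt_at_top[of 0] eventually_damping_coeff_pos[OF q_bounds(1) gamma_beta]
    proof eventually_elim
      case (elim t)
      have "norm (t powr q *\<^sub>R x' t) \<le> norm (b *\<^sub>R (x t - z) + t powr q *\<^sub>R x' t) + norm (b *\<^sub>R (x t - z))"
        using norm_triangle_ineq4[of "b *\<^sub>R (x t - z) + t powr q *\<^sub>R x' t" "b *\<^sub>R (x t - z)"] by simp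
      moreover have "norm (b *\<^sub>R (x t - z)) \<le> b * sqrt (4 * (m + 1) / b\<^sup>2)"
        using elim b by simp
      ultimately have "t powr q * norm (x' t) \<le> M" unfolding M_def using elim by simp
      then have "norm (x' t) \<le> M / t powr q" using elim by (simp add: field_simps)
      then have "damping_coeff \<gamma> \<beta> q t * norm (x' t) \<le> damping_coeff \<gamma> \<beta> q t * (M / t powr q)"
        using elim by (intro mult_left_mono) auto
      then show ?case using elim by (simp add: y_def)
    qed
    have "((\<lambda>t. M / t powr q) \<longlongrightarrow> 0) at_top" using q_bounds by real_asymp
    from tendsto_mult[OF damping_coeff_tendsto[OF q_bounds(1)] this]
    show "((\<lambda>t. damping_coeff \<gamma> \<beta> q t * (M / t powr q)) \<longlongrightarrow> 0) at_top" by simp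
  qed
  moreover have "((\<lambda>t. g (y t)) \<longlongrightarrow> g z) at_top"
  proof (rule tendsto_sandwich)
    show "eventually (\<lambda>t. g z \<le> g (y t)) at_top"
      using z by (auto simp: argmin_def is_arg_min_linorder)
    show "eventually (\<lambda>t. g (y t) \<le> g z + (m + 1) / (t powr q)\<^sup>2) at_top"
      using ev(1) eventually_gt_at_top[of 0] by eventually_elim (simp add: field_simps)
    have "((\<lambda>t. (m + 1) / (t powr q)\<^sup>2) \<longlongrightarrow> 0) at_top" using q_bounds by real_asymp
    then show "((\<lambda>t. g z + (m + 1) / (t powr q)\<^sup>2) \<longlongrightarrow> g z) at_top"
      using tendsto_add[OF tendsto_const] by fastforce
  qed simp
  ultimately show thesis using that ev(4) by blast
qed

text \<open>Subtracting two energies leaves an expression in h = |x - z|^2 and its derivative alone,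
  to which \<open>relaxation_ode_tendsto\<close> applies.\<close>

lemma norm_diff_converges:
  assumes z: "z \<in> argmin g"
  shows "\<exists>l. ((\<lambda>t. (norm (x t - z))\<^sup>2) \<longlongrightarrow> l) at_top"
proof -
  define h where "h t = inner (x t - z) (x t - z)" for t
  define h' where "h' t = 2 * inner (x t - z) (x' t)" for t
  obtain C where C: "eventually (\<lambda>t. h t \<le> C) at_top" unfolding h_def using asymptotics[OF z] by blast
  \<comment> \<open>The b^2 |x - z|^2 terms cancel, so the energy is affine in b and two values
    determine its slope. The factor 8 / \<alpha> is 2 divided by \<alpha>/2 - \<alpha>/4, the 2
    coming from h' = 2 <x - z, x'>.\<close>
  obtain m1 m2 where m: "(energy (\<alpha> / 2) z \<longlongrightarrow> m1) at_top" "(energy (\<alpha> / 4) z \<longlongrightarrow> m2) at_top"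
    using energy_converges[OF z, of "\<alpha> / 2"] energy_converges[OF z, of "\<alpha> / 4"] alpha_pos by auto
  have "((\<lambda>t. 8 / \<alpha> * (energy (\<alpha> / 2) z t - energy (\<alpha> / 4) z t)) \<longlongrightarrow> 8 / \<alpha> * (m1 - m2)) at_top"
    by (intro tendsto_intros m)
  moreover have "8 / \<alpha> * (energy (\<alpha> / 2) z t - energy (\<alpha> / 4) z t)
      = t powr q * h' t + (\<alpha> - q * t powr (q - 1)) * h t" for t
  proof -
    define X where "X = x t - z"
    show ?thesis
      unfolding energy_def h_def h'_def X_def[symmetric] using alpha_pos
      by (simp add: inner_add_left inner_add_right inner_commute field_simps power2_eq_square)
  qed
  ultimately have lim: "((\<lambda>t. t powr q * h' t + (\<alpha> - q * t powr (q - 1)) * h t) \<longlongrightarrow> 8 / \<alpha> * (m1 - m2)) at_top"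
    by simp
  \<comment> \<open>Boundedness of h makes this perturbation of the constant coefficient \<alpha>
    harmless.\<close>
  have "((\<lambda>t. q * t powr (q - 1) * h t) \<longlongrightarrow> 0) at_top"
  proof (rule Lim_null_comparison)
    show "eventually (\<lambda>t. norm (q * t powr (q - 1) * h t) \<le> q * t powr (q - 1) * C) at_top"
      using C by eventually_elim (use q_bounds in \<open>auto simp: abs_mult h_def intro!: mult_left_mono\<close>)
    show "((\<lambda>t. q * t powr (q - 1) * C) \<longlongrightarrow> 0) at_top" using q_bounds by real_asymp
  qed
  from tendsto_add[OF lim this]
  have "((\<lambda>t. t powr q * h' t + \<alpha> * h t) \<longlongrightarrow> 8 / \<alpha> * (m1 - m2)) at_top"
    by (simp add: algebra_simps)
  moreover have "eventually (\<lambda>t. (h has_real_derivative h' t) (at t)) at_top"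
    using eventually_gt_at_top[of t0]
  proof eventually_elim
    case (elim t)
    have "((\<lambda>t. x t - z) has_vector_derivative x' t) (at t)"
      using x_deriv[OF elim] by (auto intro!: derivative_eq_intros)
    from inner_has_real_derivative[OF this this] show ?case
      by (simp add: h_def[abs_def] h'_def inner_commute)
  qed
  ultimately have "(h \<longlongrightarrow> 8 / \<alpha> * (m1 - m2) / \<alpha>) at_top"
    using relaxation_ode_tendsto q_bounds alpha_pos by blast
  then show ?thesis unfolding h_def power2_norm_eq_inner by blast
qed

text \<open>Weak lower semicontinuity through the tangent at p: g(y) \<ge> g(p) + <grad g(p), y -
  p>, where the pairing tends to 0 along H because x tends weakly to p and y - x strongly to
  0.\<close>

lemma weak_cluster_point_in_argmin:
  assumes z: "z \<in> argmin g" and H: "H \<le> at_top" "H \<noteq> bot"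
    and p: "\<And>u. ((\<lambda>t. inner (x t) u) \<longlongrightarrow> inner p u) H"
  shows "p \<in> argmin g"
proof -
  obtain C where yx: "((\<lambda>t. y t - x t) \<longlongrightarrow> 0) at_top" and gy: "((\<lambda>t. g (y t)) \<longlongrightarrow> g z) at_top"
    using asymptotics[OF z] by metis
  let ?D = "gradient g p"
  have "((\<lambda>t. g p + (inner (y t - x t) ?D + inner (x t) ?D - inner p ?D)) \<longlongrightarrow>
      g p + (inner 0 ?D + inner p ?D - inner p ?D)) H"
    by (intro tendsto_intros p tendsto_mono[OF H(1) yx])
  then have "g p + (inner 0 ?D + inner p ?D - inner p ?D) \<le> g z"
  proof (rule tendsto_le[OF H(2) tendsto_mono[OF H(1) gy]])
    have "g p + (inner (y t - x t) ?D + inner (x t) ?D - inner p ?D) \<le> g (y t)" for t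
      using convex_on_above_tangent_GDERIV[OF g_convex GDERIV_gradient[OF g_diff], of p "y t"]
      by (simp add: inner_diff_left inner_diff_right inner_commute)
    then show "eventually (\<lambda>t. g p + (inner (y t - x t) ?D + inner (x t) ?D - inner p ?D) \<le> g (y t)) H"
      by simp
  qed
  then have "g p \<le> g z" by simp
  then show ?thesis using z by (auto simp: argmin_def is_arg_min_linorder intro: order_trans)
qed

lemma weak_convergence:
  assumes "argmin g \<noteq> {}"
  shows "\<exists>z\<in>argmin g. converges_weakly x z at_top"
  using assms weak_cluster_point_in_argmin norm_diff_converges
  by (intro opial) (auto simp: trivial_limit_at_top_linorder)

end

section \<open>Application to solutions of (DS)\<close>

theorem theorem6:
  fixes g :: "'a::{real_inner, complete_space} \<Rightarrow> real"
    and \<epsilon> :: "real \<Rightarrow> real"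
    and x :: "real \<Rightarrow> 'a"
    and u0 v0 :: 'a
    and t0 \<alpha> q \<gamma> \<beta> K :: real
  assumes g_convex: "convex_on UNIV g"
    and g_diff: "\<And>y. g differentiable (at y)"
    and grad_lipschitz: "\<And>B. bounded B \<Longrightarrow> \<exists>L. L-lipschitz_on B (gradient g)"
    and argmin_nonempty: "argmin g \<noteq> {}"
    and t0_pos: "t0 > 0"
    and alpha_pos: "\<alpha> > 0"
    and q_bounds: "0 < q" "q < 1"
    and gamma_beta: "\<gamma> > 0 \<or> (\<gamma> = 0 \<and> \<beta> > 0)"
    and beta_neg: "\<beta> < 0 \<Longrightarrow> t0 > \<bar>\<beta> / \<gamma>\<bar> powr (1 / q)"
    and eps_nonneg: "\<And>t. t \<ge> t0 \<Longrightarrow> \<epsilon> t \<ge> 0"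
    and eps_antimono: "antimono_on {t0..} \<epsilon>"
    and eps_C1: "\<exists>\<epsilon>'. continuous_on {t0..} \<epsilon>' \<and>
      (\<forall>t\<ge>t0. (\<epsilon> has_real_derivative \<epsilon>' t) (at t within {t0..}))"
    and eps_lim: "(\<epsilon> \<longlongrightarrow> 0) at_top"
    and solution: "DS_solution g \<epsilon> \<alpha> q \<gamma> \<beta> t0 u0 v0 x"
    and K_pos: "K > 0"
    and eps_bounds:
      "\<forall>\<^sub>F t in at_top. q * (1 - q) / t\<^sup>2 \<le> \<epsilon> t \<and> \<epsilon> t \<le> K / t powr q"
    and eps_integrable: "set_integrable lborel {t0..} (\<lambda>t. t powr q * \<epsilon> t)"
  shows "\<exists>z \<in> argmin g. converges_weakly x z at_top"
proof -
  obtain \<epsilon>' where \<epsilon>': "\<And>t. t \<ge> t0 \<Longrightarrow> (\<epsilon> has_real_derivative \<epsilon>' t) (at t within {t0..})"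
    using eps_C1 by blast
  obtain x' x'' where sol:
    "\<And>t. t \<ge> t0 \<Longrightarrow> (x has_vector_derivative x' t) (at t within {t0..})"
    "\<And>t. t \<ge> t0 \<Longrightarrow> (x' has_vector_derivative x'' t) (at t within {t0..})"
    "\<And>t. t \<ge> t0 \<Longrightarrow> x'' t + (\<alpha> / t powr q) *\<^sub>R x' t
        + gradient g (x t + damping_coeff \<gamma> \<beta> q t *\<^sub>R x' t) + \<epsilon> t *\<^sub>R x t = 0"
    using solution unfolding DS_solution_def by blast
  \<comment> \<open>Past t0 the one-sided derivatives become ordinary ones, as the energy argument
    uses them.\<close>
  have interior: "at t within {t0..} = at t" if "t > t0" for t
    using that at_within_interior[of t "{t0..}"] by simp
  interpret tikhonov_trajectory g \<alpha> q \<gamma> \<beta> t0 \<epsilon> \<epsilon>' x x' x''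
  proof
    show "eventually (\<lambda>t. q * (1 - q) / t\<^sup>2 \<le> \<epsilon> t) at_top"
      using eps_bounds by eventually_elim simp
    show "(x has_vector_derivative x' t) (at t)" "(x' has_vector_derivative x'' t) (at t)" if "t > t0" for t
      using sol(1,2)[of t] interior[OF that] that by auto
    show "x'' t = - ((\<alpha> / t powr q) *\<^sub>R x' t
        + gradient g (x t + damping_coeff \<gamma> \<beta> q t *\<^sub>R x' t) + \<epsilon> t *\<^sub>R x t)" if "t > t0" for t
      using sol(3)[OF less_imp_le[OF that]] by (simp only: eq_neg_iff_add_eq_0 add.assoc)
  qed (fact g_convex g_diff t0_pos alpha_pos q_bounds gamma_beta eps_nonneg eps_antimono eps_integrable \<epsilon>')+
  show ?thesis using weak_convergence[OF argmin_nonempty] .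
qed

end
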